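(* For all integers $t\geq 1$, we have $$\mathrm{EN}_{3,t}(1243)(q)=\frac{q^{3(t^2-t+1)}\left(1-q^{2t-1}-2q^{2t}+q^{3t-1}+q^{3t}\right)}{(1-q)(1-q^2)}.$$
   Context: For integers $s,t\ge 1$, $\mathrm{EN}_{s,t}$ is the rectangular poset on the label set $\{1,\ldots,st\}$ whose labels are arranged in $s$ rows of length $t$, row $i$ (for $0\le i\le s-1$) being $it+1,it+2,\ldots,it+t$, and whose order is generated by the relations $it+j<_{\mathrm{EN}} it+j+1$ for $0\le i\le s-1$, $1\le j\le t-1$, and $(i+1)t+j<_{\mathrm{EN}} it+j$ for $0\le i\le s-2$, $1\le j\le t$. A linear extension of $\mathrm{EN}_{s,t}$ is viewed as a permutation $\pi=\pi_1\cdots\pi_{st}\in S_{st}$ of the labels in which $a$ appears before $b$ whenever $a<_{\mathrm{EN}}b$. For example, the linear extensions of $\mathrm{EN}_{3,2}$ are $531642,536142,536412,563142,563412$. A permutation $\sigma=\sigma_1\cdots\sigma_n$ contains the pattern $\tau=\tau_1\cdots\tau_m\in S_m$ if there are indices $i_1<\cdots<i_m$ such that for all $j,l\in\{1,\ldots,m\}$ one has $\sigma_{i_j}<\sigma_{i_l}$ if and only if $\tau_j<\tau_l$; otherwise $\sigma$ avoids $\tau$. $\mathrm{EN}_{s,t}(\tau)$ is the set of linear extensions of $\mathrm{EN}_{s,t}$ that avoid $\tau$. An inversion of $\pi$ is a pair $(i,j)$ with $i<j$ and $\pi_i>\pi_j$, and $\mathrm{inv}(\pi)$ is the number of inversions of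 $\pi$. Finally, $\mathrm{EN}_{s,t}(\tau)(q)=\sum_{\pi\in \mathrm{EN}_{s,t}(\tau)}q^{\mathrm{inv}(\pi)}$. *)

theory Defs
  imports
    "HOL-Computational_Algebra.Polynomial_Factorial"
    "HOL-Combinatorics.Multiset_Permutations"
begin

text \<open>
  A permutation of \<open>{1..n}\<close> is represented by its one-line notation, an element of
  \<open>permutations_of_set {1..n}\<close>. Positions in the list are counted from 0, so that
  \<open>\<pi> ! i\<close> is the letter usually written with index \<open>i + 1\<close>.
\<close>

definition EN_gens :: "nat \<Rightarrow> nat \<Rightarrow> (nat \<times> nat) set" where
  "EN_gens s t =
     {(i * t + j, i * t + j + 1) |i j. i < s \<and> 1 \<le> j \<and> j < t} \<union>
     {((i + 1) * t + j, i * t + j) |i j. i + 1 < s \<and> 1 \<le> j \<and> j \<le> t}"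

definition EN_less :: "nat \<Rightarrow> nat \<Rightarrow> (nat \<times> nat) set" where
  "EN_less s t = (EN_gens s t)\<^sup>+"

definition EN_linear_extensions :: "nat \<Rightarrow> nat \<Rightarrow> nat list set" where
  "EN_linear_extensions s t =
     {\<pi> \<in> permutations_of_set {1..s * t}.
        \<forall>i < length \<pi>. \<forall>j < length \<pi>. (\<pi> ! i, \<pi> ! j) \<in> EN_less s t \<longrightarrow> i < j}"

definition contains_pattern :: "nat list \<Rightarrow> nat list \<Rightarrow> bool" where
  "contains_pattern \<sigma> \<tau> \<longleftrightarrow>
     (\<exists>f :: nat \<Rightarrow> nat.
        strict_mono_on {..<length \<tau>} f \<and> f ` {..<length \<tau>} \<subseteq> {..<length \<sigma>} \<and>
        (\<forall>j < length \<tau>. \<forall>l < length \<tau>. \<sigma> ! f j < \<sigma> ! f l \<longleftrightarrow> \<tau> ! j < \<tau> ! l))"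

definition EN_avoiding :: "nat \<Rightarrow> nat \<Rightarrow> nat list \<Rightarrow> nat list set" where
  "EN_avoiding s t \<tau> = {\<pi> \<in> EN_linear_extensions s t. \<not> contains_pattern \<pi> \<tau>}"

definition inv_count :: "nat list \<Rightarrow> nat" where
  "inv_count \<pi> = card {(i, j). i < j \<and> j < length \<pi> \<and> \<pi> ! i > \<pi> ! j}"

definition EN_genfun :: "nat \<Rightarrow> nat \<Rightarrow> nat list \<Rightarrow> int poly" where
  "EN_genfun s t \<tau> = (\<Sum>\<pi>\<in>EN_avoiding s t \<tau>. monom 1 (inv_count \<pi>))"

text \<open>
  The indeterminate as an element of the fraction field of the integer polynomials, in which
  quotients of polynomials are formed.
\<close>

definition q_var :: "int poly fract" where
  "q_var = to_fract (monom 1 1)"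

end

theory Submission
  imports Defs
begin

text \<open>
  Write \<open>A = {1..t}\<close>, \<open>B = {t+1..2t}\<close>, \<open>C = {2t+1..3t}\<close> for the three rows. In a linear extension
  the last letter of a row comes after everything that lies in later rows. Avoiding 1243 therefore
  forces every letter of \<open>B\<close> and \<open>C\<close> to precede the second letter of \<open>A\<close> (otherwise the letters
  \<open>1, 2\<close>, the offending letter, and \<open>t\<close> form the pattern), and every letter of \<open>C\<close> to precede the
  second letter of \<open>B\<close>. Conversely these conditions exclude the pattern. Only the positions of
  \<open>t+1\<close> among the letters of \<open>C\<close> and of \<open>1\<close> among the letters of \<open>B\<close> and \<open>C\<close> after \<open>t+1\<close> remain
  free; they are recorded by \<open>j < t\<close> and \<open>p < 2t - 1 - j\<close>, and the number of inversions is
  \<open>3(t\<^sup>2 - t + 1) + 2j + p\<close>. Summing two geometric series gives the formula.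
\<close>

section \<open>Relative order of the letters of a word\<close>

text \<open>Positions become a relation on letters that the simplifier evaluates block by block
  along \<open>#\<close>, \<open>@\<close> and intervals. For a distinct list it is a strict total
  order on the letters.\<close>

definition before :: "'a list \<Rightarrow> 'a \<Rightarrow> 'a \<Rightarrow> bool" where
  "before xs x y \<longleftrightarrow> (\<exists>i j. i < j \<and> j < length xs \<and> xs ! i = x \<and> xs ! j = y)"

lemma before_Nil [simp]: "\<not> before [] x y"
  by (simp add: before_def)

lemma before_Cons [simp]: "before (z # xs) x y \<longleftrightarrow> x = z \<and> y \<in> set xs \<or> before xs x y"
proof
  assume "before (z # xs) x y"
  then obtain i j where ij: "i < j" "j < Suc (length xs)" "(z # xs) ! i = x" "(z # xs) ! j = y"
    by (auto simp: before_def)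
  then obtain j' where j: "j = Suc j'" by (cases j) auto
  show "x = z \<and> y \<in> set xs \<or> before xs x y"
    using ij j by (cases i) (auto simp: before_def)
next
  assume "x = z \<and> y \<in> set xs \<or> before xs x y"
  then show "before (z # xs) x y"
  proof
    assume "x = z \<and> y \<in> set xs"
    then obtain j where "j < length xs" "xs ! j = y" "x = z"
      by (auto simp: in_set_conv_nth)
    then show ?thesis unfolding before_def by (intro exI[of _ 0] exI[of _ "Suc j"]) auto
  next
    assume "before xs x y"
    then obtain i j where "i < j" "j < length xs" "xs ! i = x" "xs ! j = y"
      by (auto simp: before_def)
    then show ?thesis unfolding before_def by (intro exI[of _ "Suc i"] exI[of _ "Suc j"]) auto
  qed
qed

lemma before_append [simp]:
  "before (xs @ ys) x y \<longleftrightarrow> before xs x y \<or> before ys x y \<or> x \<in> set xs \<and> y \<in> set ys"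
  by (induction xs) auto

lemma before_in_set: "before xs x y \<Longrightarrow> x \<in> set xs \<and> y \<in> set xs"
  by (auto simp: before_def)

lemma before_upt [simp]: "before [m..<n] x y \<longleftrightarrow> m \<le> x \<and> x < y \<and> y < n"
  by (induction n) (auto simp: less_Suc_eq)

lemma before_trans: "distinct xs \<Longrightarrow> before xs x y \<Longrightarrow> before xs y z \<Longrightarrow> before xs x z"
  by (induction xs) (auto dest: before_in_set)

lemma before_asym: "distinct xs \<Longrightarrow> before xs x y \<Longrightarrow> \<not> before xs y x"
  by (induction xs) (auto dest: before_in_set)

lemma before_total: "x \<in> set xs \<Longrightarrow> y \<in> set xs \<Longrightarrow> x \<noteq> y \<Longrightarrow> before xs x y \<or> before xs y x"
  by (induction xs) auto

lemma sorted_wrt_before: "sorted_wrt (before xs) xs"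
  by (auto simp: sorted_wrt_iff_nth_less before_def)

text \<open>A strict total order admits only one increasing enumeration of a finite set: both heads
  must be its least element. This later identifies a linear extension with an explicit word.\<close>

lemma sorted_wrt_before_unique:
  assumes "distinct zs" "sorted_wrt (before zs) xs" "sorted_wrt (before zs) ys"
    and "distinct xs" "distinct ys" "set xs = set ys"
  shows "xs = ys"
  using assms(2-)
proof (induction xs arbitrary: ys)
  case (Cons x xs)
  then obtain y ys' where ys: "ys = y # ys'" by (cases ys) auto
  have xy: "x = y"
  proof (rule ccontr)
    assume "x \<noteq> y"
    then have "y \<in> set xs" "x \<in> set ys'" using Cons.prems(5) ys by auto
    then have "before zs x y" "before zs y x" using Cons.prems ys by auto
    then show False using before_asym[OF assms(1)] by blast
  qed
  moreover have "xs = ys'"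
  proof (rule Cons.IH)
    show "set xs = set ys'" using Cons.prems xy ys by auto
  qed (use Cons.prems ys in auto)
  ultimately show ?case using ys by simp
qed auto

lemma before_index_less:
  assumes "distinct xs" "before xs (xs ! i) (xs ! j)" "i < length xs" "j < length xs"
  shows "i < j"
  using assms by (auto simp: before_def nth_eq_iff_index_eq)

text \<open>The three comparisons of neighbouring positions and the value chain
  \<open>x < y < v < z\<close> determine all other comparisons by transitivity.\<close>

lemma contains_1243_iff:
  assumes "distinct \<sigma>"
  shows "contains_pattern \<sigma> [1, 2, 4, 3] \<longleftrightarrow>
    (\<exists>x y z v. before \<sigma> x y \<and> before \<sigma> y z \<and> before \<sigma> z v \<and> x < y \<and> y < v \<and> v < z)"
proof
  assume "contains_pattern \<sigma> [1, 2, 4, 3]"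
  then obtain f where f: "strict_mono_on {..<4::nat} f" "f ` {..<4} \<subseteq> {..<length \<sigma>}"
    "\<forall>j<4. \<forall>l<4. \<sigma> ! f j < \<sigma> ! f l \<longleftrightarrow> [1::nat, 2, 4, 3] ! j < [1, 2, 4, 3] ! l"
    unfolding contains_pattern_def by (auto simp: eval_nat_numeral)
  have "f 0 < f 1" "f 1 < f 2" "f 2 < f 3"
    using f(1) by (auto simp: strict_mono_on_def)
  moreover have "f 3 < length \<sigma>" using f(2) by (simp add: image_subset_iff)
  moreover have "\<sigma> ! f 0 < \<sigma> ! f 1" "\<sigma> ! f 1 < \<sigma> ! f 3" "\<sigma> ! f 3 < \<sigma> ! f 2"
    using f(3) by simp_all
  moreover have "before \<sigma> (\<sigma> ! i) (\<sigma> ! j)" if "i < j" "j < length \<sigma>" for i j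
    using that by (auto simp: before_def)
  ultimately show "\<exists>x y z v. before \<sigma> x y \<and> before \<sigma> y z \<and> before \<sigma> z v \<and> x < y \<and> y < v \<and> v < z"
    by (meson less_trans)
next
  assume "\<exists>x y z v. before \<sigma> x y \<and> before \<sigma> y z \<and> before \<sigma> z v \<and> x < y \<and> y < v \<and> v < z"
  then obtain x y z v where *: "before \<sigma> x y" "before \<sigma> y z" "before \<sigma> z v" "x < y" "y < v" "v < z"
    by blast
  then have "{x, y, z, v} \<subseteq> set \<sigma>" by (auto dest: before_in_set)
  then obtain a b c d where idx: "x = \<sigma> ! a" "y = \<sigma> ! b" "z = \<sigma> ! c" "v = \<sigma> ! d"
    "a < length \<sigma>" "b < length \<sigma>" "c < length \<sigma>" "d < length \<sigma>"
    by (auto simp: in_set_conv_nth)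
  have ord: "a < b" "b < c" "c < d"
    using * idx before_index_less[OF assms] by auto
  \<comment> \<open>Enumerating the indices lets \<open>auto\<close> check all sixteen
    comparisons.\<close>
  have four: "k < 4 \<longleftrightarrow> k = 0 \<or> k = 1 \<or> k = 2 \<or> k = 3" for k :: nat by auto
  have len: "length [1::nat, 2, 4, 3] = 4" by simp
  show "contains_pattern \<sigma> [1, 2, 4, 3]"
    unfolding contains_pattern_def len
  proof (intro exI[of _ "\<lambda>k. [a, b, c, d] ! k"] conjI)
    show "strict_mono_on {..<4} ((!) [a, b, c, d])"
      using ord by (auto simp: strict_mono_on_def four)
    show "(!) [a, b, c, d] ` {..<4} \<subseteq> {..<length \<sigma>}"
      using idx by (auto simp: four)
    show "\<forall>j<4. \<forall>l<4.
        (\<sigma> ! ([a, b, c, d] ! j) < \<sigma> ! ([a, b, c, d] ! l)) =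
        ([1::nat, 2, 4, 3] ! j < [1, 2, 4, 3] ! l)"
      using * idx by (auto simp: four)
  qed
qed

section \<open>The avoiding linear extensions\<close>

text \<open>The clauses say in turn: rows increase; \<open>C\<close> precedes \<open>B\<close>
  without its first letter; \<open>B\<close> and \<open>C\<close> precede \<open>A\<close> without
  its first letter. The last two are the column relations in the first column, the only ones that do
  not follow from the earlier clauses.\<close>

definition avoiding_order :: "nat \<Rightarrow> (nat \<Rightarrow> nat \<Rightarrow> bool) \<Rightarrow> bool" where
  "avoiding_order t R \<longleftrightarrow>
     (\<forall>x y. x < y \<longrightarrow> (1 \<le> x \<and> y \<le> t \<or> t < x \<and> y \<le> 2 * t \<or> 2 * t < x \<and> y \<le> 3 * t) \<longrightarrow> R x y) \<and>
     (\<forall>x y. 2 * t < x \<longrightarrow> x \<le> 3 * t \<longrightarrow> t + 2 \<le> y \<longrightarrow> y \<le> 2 * t \<longrightarrow> R x y) \<and>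
     (\<forall>x y. t < x \<longrightarrow> x \<le> 3 * t \<longrightarrow> 2 \<le> y \<longrightarrow> y \<le> t \<longrightarrow> R x y) \<and>
     R (2 * t + 1) (t + 1) \<and> R (t + 1) 1"

lemma avoiding_orderD:
  assumes "avoiding_order t R"
  shows "x < y \<Longrightarrow> 1 \<le> x \<and> y \<le> t \<or> t < x \<and> y \<le> 2 * t \<or> 2 * t < x \<and> y \<le> 3 * t \<Longrightarrow> R x y"
    and "2 * t < x \<Longrightarrow> x \<le> 3 * t \<Longrightarrow> t + 2 \<le> y \<Longrightarrow> y \<le> 2 * t \<Longrightarrow> R x y"
    and "t < x \<Longrightarrow> x \<le> 3 * t \<Longrightarrow> 2 \<le> y \<Longrightarrow> y \<le> t \<Longrightarrow> R x y"
    and "R (2 * t + 1) (t + 1)" and "R (t + 1) 1"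
  using assms unfolding avoiding_order_def by blast+

text \<open>Since \<open>before \<pi>\<close> is transitive for a distinct word, checking the
  generators suffices for their transitive closure. The range condition ensures that generators
  speak only about letters of the word.\<close>

lemma EN_linear_extensions_iff_before:
  assumes "distinct \<pi>" "set \<pi> = {1..s * t}" "EN_gens s t \<subseteq> {1..s * t} \<times> {1..s * t}"
  shows "\<pi> \<in> EN_linear_extensions s t \<longleftrightarrow> (\<forall>(x, y) \<in> EN_gens s t. before \<pi> x y)"
proof
  assume le: "\<pi> \<in> EN_linear_extensions s t"
  show "\<forall>(x, y) \<in> EN_gens s t. before \<pi> x y"
  proof clarify
    fix x y assume xy: "(x, y) \<in> EN_gens s t"
    with assms obtain i j where ij: "i < length \<pi>" "j < length \<pi>" "x = \<pi> ! i" "y = \<pi> ! j"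
      by (metis in_set_conv_nth mem_Sigma_iff subsetD)
    then have "i < j" using le xy unfolding EN_linear_extensions_def EN_less_def by blast
    then show "before \<pi> x y" using ij by (auto simp: before_def)
  qed
next
  assume gens: "\<forall>(x, y) \<in> EN_gens s t. before \<pi> x y"
  have "before \<pi> x y" if "(x, y) \<in> EN_less s t" for x y
    using that unfolding EN_less_def
    by (induction rule: trancl_induct) (use gens before_trans[OF assms(1)] in blast)+
  then show "\<pi> \<in> EN_linear_extensions s t"
    using assms(1,2) before_index_less[OF assms(1)]
    by (auto simp: EN_linear_extensions_def intro: permutations_of_setI)
qed

lemma EN_gens_3_range:
  "EN_gens 3 t \<subseteq> {1..3 * t} \<times> {1..3 * t}"
proof -
  have three: "i < 3 \<longleftrightarrow> i = 0 \<or> i = 1 \<or> i = 2" for i :: nat by auto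
  have two: "i + 1 < 3 \<longleftrightarrow> i = 0 \<or> i = 1" for i :: nat by auto
  show ?thesis unfolding EN_gens_def three two by auto
qed

text \<open>Forwards, each violated clause exhibits a 1243 that ends in the last letter of a row.
  Backwards, the clauses force any occurrence of 1243 to begin with \<open>1\<close>,
  \<open>t + 1\<close>, in an order that the last clause forbids.\<close>

lemma EN_avoiding_iff_avoiding_order:
  assumes t: "t \<ge> 1" and dist: "distinct \<pi>" and set: "set \<pi> = {1..3 * t}"
  shows "\<pi> \<in> EN_avoiding 3 t [1, 2, 4, 3] \<longleftrightarrow> avoiding_order t (before \<pi>)"
proof
  assume av: "\<pi> \<in> EN_avoiding 3 t [1, 2, 4, 3]"
  then have "\<pi> \<in> EN_linear_extensions 3 t" by (simp add: EN_avoiding_def)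
  then have gens: "before \<pi> x y" if "(x, y) \<in> EN_gens 3 t" for x y
    using that EN_linear_extensions_iff_before[OF dist set EN_gens_3_range] by blast
  have no: "\<not> (before \<pi> x y \<and> before \<pi> y z \<and> before \<pi> z v \<and> x < y \<and> y < v \<and> v < z)" for x y z v
    using av contains_1243_iff[OF dist] by (auto simp: EN_avoiding_def)
  note trans = before_trans[OF dist]
  have step: "before \<pi> (i * t + j) (i * t + j + 1)" if "i < 3" "1 \<le> j" "j < t" for i j
    using that by (intro gens) (auto simp: EN_gens_def)
  have row: "before \<pi> (i * t + j) (i * t + k)" if "i < 3" "1 \<le> j" "j < k" "k \<le> t" for i j k
    using that(3,4)
  proof (induction k)
    case (Suc k)
    show ?case
    proof (cases "j = k")
      case True
      then show ?thesis using step[of i j] that Suc.prems by simp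
    next
      case False
      then show ?thesis using Suc step[of i k] that trans by fastforce
    qed
  qed simp
  have col: "before \<pi> ((i + 1) * t + j) (i * t + j)" if "i < 2" "1 \<le> j" "j \<le> t" for i j
    using that by (intro gens) (auto simp: EN_gens_def)
  have A: "before \<pi> x y" if "1 \<le> x" "x < y" "y \<le> t" for x y
    using row[of 0 x y] that by simp
  have B: "before \<pi> x y" if "t < x" "x < y" "y \<le> 2 * t" for x y
    using row[of 1 "x - t" "y - t"] that by simp
  have C: "before \<pi> x y" if "2 * t < x" "x < y" "y \<le> 3 * t" for x y
    using row[of 2 "x - 2 * t" "y - 2 * t"] that by simp
  have last_BA: "before \<pi> (2 * t) t" using col[of 0 t] t by (simp add: mult_2)
  have last_CB: "before \<pi> (3 * t) (2 * t)"
    using col[of 1 t] t by (simp add: numeral_eq_Suc add_ac)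
  \<comment> \<open>If \<open>y\<close> came first, then \<open>t + 2\<close> would precede
    \<open>3 * t\<close>, and \<open>t + 1\<close>, \<open>t + 2\<close>, \<open>3 * t\<close>,
    \<open>2 * t\<close> would form 1243. The degenerate case \<open>t + 2 = 2 * t\<close>
    contradicts \<open>last_CB\<close>.\<close>
  have C_B: "before \<pi> x y" if xy: "2 * t < x" "x \<le> 3 * t" "t + 2 \<le> y" "y \<le> 2 * t" for x y
  proof (rule ccontr)
    assume "\<not> before \<pi> x y"
    then have "before \<pi> y x" using before_total[of y \<pi> x] set xy by auto
    moreover have "before \<pi> x (3 * t) \<or> x = 3 * t" using C[of x "3 * t"] xy by linarith
    moreover have "before \<pi> (t + 2) y \<or> y = t + 2" using B[of "t + 2" y] xy by linarith
    ultimately have "before \<pi> (t + 2) (3 * t)" using trans by blast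
    moreover from this have "t + 2 \<noteq> 2 * t" using before_asym[OF dist] last_CB by metis
    moreover have "before \<pi> (t + 1) (t + 2)" using B xy by simp
    ultimately show False using no[of "t + 1" "t + 2" "3 * t" "2 * t"] last_CB xy by auto
  qed
  have last: "before \<pi> x t" if x: "t < x" "x \<le> 3 * t" for x
  proof (cases "x \<le> 2 * t")
    case True
    then show ?thesis using B[of x "2 * t"] last_BA trans x by (cases "x = 2 * t") auto
  next
    case False
    then have "before \<pi> x (3 * t) \<or> x = 3 * t" using C[of x "3 * t"] x by linarith
    then show ?thesis using last_CB last_BA trans by blast
  qed
  \<comment> \<open>Here \<open>1\<close>, \<open>2\<close>, \<open>x\<close>, \<open>t\<close>
    would form 1243; if \<open>t = 2\<close>, the order of \<open>2\<close> and \<open>x\<close>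
    already contradicts \<open>last\<close>.\<close>
  have BC_A: "before \<pi> x y" if xy: "t < x" "x \<le> 3 * t" "2 \<le> y" "y \<le> t" for x y
  proof (rule ccontr)
    assume "\<not> before \<pi> x y"
    then have "before \<pi> y x" using before_total[of y \<pi> x] set xy by auto
    moreover have "before \<pi> 2 y \<or> y = 2" using A[of 2 y] xy by linarith
    ultimately have "before \<pi> 2 x" using trans by blast
    moreover from this have "2 \<noteq> t" using before_asym[OF dist] last[of x] xy by metis
    moreover have "before \<pi> 1 2" using A xy by simp
    ultimately show False using no[of 1 2 x t] last[of x] xy by auto
  qed
  have "before \<pi> (2 * t + 1) (t + 1)" "before \<pi> (t + 1) 1"
    using col[of 1 1] col[of 0 1] t by (auto simp: mult_2)
  then show "avoiding_order t (before \<pi>)"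
    unfolding avoiding_order_def using A B C C_B BC_A by blast
next
  assume ao: "avoiding_order t (before \<pi>)"
  note row = avoiding_orderD(1)[OF ao] and CB = avoiding_orderD(2)[OF ao]
    and BCA = avoiding_orderD(3)[OF ao] and firsts = avoiding_orderD(4,5)[OF ao]
  have "before \<pi> x y" if "(x, y) \<in> EN_gens 3 t" for x y
  proof -
    from that consider (horizontal) i j where "x = i * t + j" "y = i * t + j + 1" "i < 3" "1 \<le> j" "j < t"
      | (vertical) i j where "x = (i + 1) * t + j" "y = i * t + j" "i < 2" "1 \<le> j" "j \<le> t"
      by (auto simp: EN_gens_def)
    then show ?thesis
    proof cases
      case horizontal
      then have "i = 0 \<or> i = 1 \<or> i = 2" by auto
      then show ?thesis using horizontal row[of x y] by auto
    next
      case vertical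
      then consider "i = 0" "j = 1" | "i = 1" "j = 1" | "i = 0" "j \<ge> 2" | "i = 1" "j \<ge> 2" by linarith
      then show ?thesis using vertical firsts CB[of x y] BCA[of x y] by cases (auto simp: mult_2)
    qed
  qed
  then have le: "\<pi> \<in> EN_linear_extensions 3 t"
    using EN_linear_extensions_iff_before[OF dist set EN_gens_3_range] by blast
  have False if p: "before \<pi> x y" "before \<pi> y z" "before \<pi> z v" "x < y" "y < v" "v < z" for x y z v
  proof -
    have mem: "x \<in> {1..3 * t}" "y \<in> {1..3 * t}" "z \<in> {1..3 * t}" "v \<in> {1..3 * t}"
      using p(1-3) before_in_set set by metis+
    note asym = before_asym[OF dist]
    \<comment> \<open>From the second letter of \<open>A\<close> on, only letters of
      \<open>A\<close> can follow; \<open>after_B\<close> says likewise that no letter of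
      \<open>C\<close> follows the second letter of \<open>B\<close>.\<close>
    have after_A: "u' \<le> t" if "before \<pi> u u'" "2 \<le> u" "u \<le> t" for u u'
      using asym[OF that(1)] BCA[of u' u] that before_in_set[OF that(1)] set by force
    have after_B: "u' \<le> 2 * t" if "before \<pi> u u'" "t + 2 \<le> u" "u \<le> 2 * t" for u u'
      using asym[OF that(1)] CB[of u' u] that before_in_set[OF that(1)] set by force
    have "\<not> before \<pi> v z" using asym p(3) by blast
    \<comment> \<open>Rows increase, so the descent from \<open>z\<close> to \<open>v\<close> must
      go from a later row to an earlier one.\<close>
    then have rows: "v \<le> t \<and> t < z \<or> t < v \<and> v \<le> 2 * t \<and> 2 * t < z"
      using row[of v z] p(6) mem by fastforce
    \<comment> \<open>Otherwise \<open>y\<close> lies in \<open>A\<close> and is at least 2, so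
      \<open>z\<close> after it would lie in \<open>A\<close>, against \<open>rows\<close>. The same
      kind of argument then leaves only \<open>y = t + 1\<close> and \<open>x = 1\<close>.\<close>
    have "y > t"
      using after_A[OF p(2)] p(4-6) mem rows by fastforce
    then have v: "t < v" "v \<le> 2 * t" "2 * t < z" using rows p by auto
    then have y: "y = t + 1" using after_B[OF p(2)] p \<open>y > t\<close> by fastforce
    then have "x = 1" using after_A[OF p(1)] p(4) mem by fastforce
    then show False using asym p(1) y firsts(2) by blast
  qed
  then show "\<pi> \<in> EN_avoiding 3 t [1, 2, 4, 3]"
    using le contains_1243_iff[OF dist] by (auto simp: EN_avoiding_def)
qed

section \<open>The two-parameter family of words\<close>

declare upt_Suc [simp del]

text \<open>These are the letters of \<open>B\<close> and \<open>C\<close> that come after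
  \<open>t + 1\<close>, in their forced order. The parameter \<open>j\<close> counts the letters of
  \<open>C\<close> other than \<open>2 * t + 1\<close> that precede \<open>t + 1\<close>.\<close>

definition late_word :: "nat \<Rightarrow> nat \<Rightarrow> nat list" where
  "late_word t j = [2 * t + 2 + j..<3 * t + 1] @ [t + 2..<2 * t + 1]"

text \<open>The parameter \<open>p\<close> counts the letters of \<open>late_word t j\<close> that
  precede \<open>1\<close>. As that word has length \<open>2 * t - 2 - j\<close>, there are
  \<open>2 * t - 1 - j\<close> slots for \<open>1\<close>.\<close>

definition avoiding_word :: "nat \<Rightarrow> nat \<Rightarrow> nat \<Rightarrow> nat list" where
  "avoiding_word t j p =
     [2 * t + 1..<2 * t + 2 + j] @ (t + 1) #
     take p (late_word t j) @ 1 # drop p (late_word t j) @ [2..<t + 1]"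

lemma length_late_word: "j < t \<Longrightarrow> length (late_word t j) = 2 * t - 2 - j"
  by (auto simp: late_word_def less_iff_Suc_add)

lemma set_late_word: "set (late_word t j) = {2 * t + 2 + j..3 * t} \<union> {t + 2..2 * t}"
  by (auto simp: late_word_def)

lemma set_take_Un_drop: "set (take p xs) \<union> set (drop p xs) = set xs"
  by (metis append_take_drop_id set_append)

lemma before_take_drop:
  "before xs x y \<longleftrightarrow>
    before (take p xs) x y \<or> before (drop p xs) x y \<or> x \<in> set (take p xs) \<and> y \<in> set (drop p xs)"
  by (metis append_take_drop_id before_append)

text \<open>Moving \<open>1\<close> in front of the late letters removes \<open>take\<close> and
  \<open>drop\<close>, so letters and distinctness can be read off intervals independently of
  \<open>p\<close>.\<close>

lemma mset_avoiding_word: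
  "mset (avoiding_word t j p) =
    mset ([2 * t + 1..<2 * t + 2 + j] @ (t + 1) # 1 # late_word t j @ [2..<t + 1])"
proof -
  have "mset (late_word t j) = mset (take p (late_word t j)) + mset (drop p (late_word t j))"
    by (metis append_take_drop_id mset_append)
  then show ?thesis unfolding avoiding_word_def by simp
qed

lemma avoiding_word_set:
  assumes "j < t"
  shows "set (avoiding_word t j p) = {1..3 * t}"
proof -
  have "set (avoiding_word t j p) =
      set ([2 * t + 1..<2 * t + 2 + j] @ (t + 1) # 1 # late_word t j @ [2..<t + 1])"
    by (rule mset_eq_setD[OF mset_avoiding_word])
  also have "\<dots> = {1..3 * t}"
    using assms by (auto simp: set_late_word)
  finally show ?thesis .
qed

lemma avoiding_word_distinct:
  assumes "j < t"
  shows "distinct (avoiding_word t j p)"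
proof -
  have "distinct ([2 * t + 1..<2 * t + 2 + j] @ (t + 1) # 1 # late_word t j @ [2..<t + 1])"
    using assms by (auto simp: late_word_def)
  then show ?thesis
    using mset_eq_imp_distinct_iff[OF mset_avoiding_word] by blast
qed

lemma avoiding_order_avoiding_word:
  assumes "j < t"
  shows "avoiding_order t (before (avoiding_word t j p))"
proof -
  let ?R = "late_word t j"
  \<comment> \<open>Inserting \<open>1\<close> does not change the relative order of the late
    letters.\<close>
  have R: "before (avoiding_word t j p) x y" if "before ?R x y" for x y
    using that before_take_drop[of ?R x y p] by (auto simp: avoiding_word_def)
  have mem: "x \<in> set (take p ?R) \<or> x \<in> set (drop p ?R)"
    if "2 * t + 2 + j \<le> x \<and> x \<le> 3 * t \<or> t + 2 \<le> x \<and> x \<le> 2 * t" for x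
  proof -
    have "x \<in> set ?R" using that by (auto simp: set_late_word)
    then show ?thesis using set_take_Un_drop[of p ?R] by blast
  qed
  have CB: "before (avoiding_word t j p) x y" if "2 * t < x" "x \<le> 3 * t" "t + 2 \<le> y" "y \<le> 2 * t" for x y
  proof (cases "x < 2 * t + 2 + j")
    case True
    moreover have "y \<in> set (take p ?R) \<or> y \<in> set (drop p ?R)"
      by (intro mem) (use that True in linarith)
    ultimately show ?thesis using that by (auto simp: avoiding_word_def)
  next
    case False
    then show ?thesis using that by (intro R) (auto simp: late_word_def)
  qed
  have BCA: "before (avoiding_word t j p) x y" if "t < x" "x \<le> 3 * t" "2 \<le> y" "y \<le> t" for x y
  proof (cases "x = t + 1 \<or> 2 * t + 1 \<le> x \<and> x < 2 * t + 2 + j")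
    case True
    then show ?thesis using that by (auto simp: avoiding_word_def)
  next
    case False
    then have "x \<in> set (take p ?R) \<or> x \<in> set (drop p ?R)" 
      by (intro mem) (use that in linarith)
    then show ?thesis using that by (auto simp: avoiding_word_def)
  qed
  have A: "before (avoiding_word t j p) x y" if "1 \<le> x" "x < y" "y \<le> t" for x y
    using that by (auto simp: avoiding_word_def)
  have B: "before (avoiding_word t j p) x y" if "t < x" "x < y" "y \<le> 2 * t" for x y
  proof (cases "x = t + 1")
    case True
    moreover have "y \<in> set (take p ?R) \<or> y \<in> set (drop p ?R)"
      by (intro mem) (use that True in linarith)
    ultimately show ?thesis using that by (auto simp: avoiding_word_def)
  next
    case False
    then have "t + 2 \<le> x" using that by simp
    then show ?thesis using that by (intro R) (simp add: late_word_def)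
  qed
  have C: "before (avoiding_word t j p) x y" if "2 * t < x" "x < y" "y \<le> 3 * t" for x y
  proof (cases "x < 2 * t + 2 + j")
    case True
    note x = True
    show ?thesis
    proof (cases "y < 2 * t + 2 + j")
      case True
      then show ?thesis using that by (simp add: avoiding_word_def)
    next
      case False
      then have "y \<in> set (take p ?R) \<or> y \<in> set (drop p ?R)" 
        by (intro mem) (use that in linarith)
      then show ?thesis using x that by (auto simp: avoiding_word_def)
    qed
  next
    case False
    then show ?thesis using that by (intro R) (simp add: late_word_def)
  qed
  have "before (avoiding_word t j p) (2 * t + 1) (t + 1)" "before (avoiding_word t j p) (t + 1) 1"
    by (auto simp: avoiding_word_def)
  then show ?thesis
    unfolding avoiding_order_def using A B C CB BCA by blast
qed

section \<open>Recovering the parameters from the order\<close>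

lemma sorted_wrt_dropWhile_before:
  assumes "distinct zs" "set xs \<subseteq> set zs" "a \<in> set zs" "a \<notin> set xs"
    and "sorted_wrt (before zs) xs" "x \<in> set (dropWhile (\<lambda>x. before zs x a) xs)"
  shows "before zs a x"
  using assms(2,4-)
proof (induction xs)
  case (Cons y ys)
  show ?case
  proof (cases "before zs y a")
    case True
    then show ?thesis using Cons by auto
  next
    \<comment> \<open>The first letter not preceding \<open>a\<close> comes after \<open>a\<close>,
      and by transitivity so do all later ones. Hence in an increasing list the letters before
      \<open>a\<close> form an initial segment.\<close>
    case False
    then have "before zs a y" using before_total[of a zs y] Cons.prems assms(3) by auto
    moreover have "x = y \<or> before zs y x" using Cons.prems False by auto
    ultimately show ?thesis using before_trans[OF assms(1)] by blast
  qed
qed simp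

text \<open>Cutting row \<open>C\<close> at \<open>t + 1\<close> yields \<open>j\<close>, and
  cutting the late letters at \<open>1\<close> yields \<open>p\<close>. The resulting word is
  increasing for \<open>before \<pi>\<close>, hence equals \<open>\<pi>\<close> by
  uniqueness.\<close>

lemma avoiding_order_imp_avoiding_word:
  assumes t: "t \<ge> 1" and dist: "distinct \<pi>" and set: "set \<pi> = {1..3 * t}"
    and ao: "avoiding_order t (before \<pi>)"
  obtains j p where "j < t" "p < 2 * t - 1 - j" "\<pi> = avoiding_word t j p"
proof -
  note row = avoiding_orderD(1)[OF ao] and CB = avoiding_orderD(2)[OF ao]
    and BCA = avoiding_orderD(3)[OF ao] and firsts = avoiding_orderD(4,5)[OF ao]
  note trans = before_trans[OF dist]
  have upt: "sorted_wrt (before \<pi>) [m..<n]"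
    if "\<And>x y. m \<le> x \<Longrightarrow> x < y \<Longrightarrow> y < n \<Longrightarrow> before \<pi> x y" for m n
    using that by (auto simp: sorted_wrt_iff_nth_less)
  let ?C = "[2 * t + 1..<3 * t + 1]"
  have C_sorted: "sorted_wrt (before \<pi>) ?C" by (rule upt) (auto intro: row)
  define C1 where "C1 = takeWhile (\<lambda>x. before \<pi> x (t + 1)) ?C"
  define C2 where "C2 = dropWhile (\<lambda>x. before \<pi> x (t + 1)) ?C"
  have C_split: "?C = C1 @ C2" by (simp add: C1_def C2_def)
  define l where "l = length C1"
  \<comment> \<open>\<open>2 * t + 1\<close> always precedes \<open>t + 1\<close>, so nothing is
    truncated in \<open>l - 1\<close>.\<close>
  have "C1 \<noteq> []" unfolding C1_def using firsts t by (simp add: upt_rec)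
  then have "l \<ge> 1" by (cases C1) (auto simp: l_def)
  define j where "j = l - 1"
  have "length C1 + length C2 = t"
    using arg_cong[OF C_split, of length] by simp
  then have jt: "j < t" using \<open>l \<ge> 1\<close> by (simp add: l_def j_def)
  have "C1 = take l ?C" "C2 = drop l ?C" using C_split by (simp_all add: l_def)
  then have C12: "C1 = [2 * t + 1..<2 * t + 2 + j]" "C2 = [2 * t + 2 + j..<3 * t + 1]"
    using \<open>l \<ge> 1\<close> jt by (simp_all add: j_def take_upt)
  have C1_b: "before \<pi> x (t + 1)" if "x \<in> set C1" for x
    using that by (auto simp: C1_def dest: set_takeWhileD)
  have b_C2: "before \<pi> (t + 1) x" if "x \<in> set C2" for x
    by (rule sorted_wrt_dropWhile_before[OF dist _ _ _ C_sorted that[unfolded C2_def]])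
      (use t in \<open>auto simp: set\<close>)
  let ?R = "late_word t j"
  have R_eq: "?R = C2 @ [t + 2..<2 * t + 1]" by (simp add: late_word_def C12)
  have "sorted_wrt (before \<pi>) [2 * t + 2 + j..<3 * t + 1]"
    "sorted_wrt (before \<pi>) [t + 2..<2 * t + 1]"
    by (rule upt; rule row; simp)+
  \<comment> \<open>The two runs are joined by the clause that puts \<open>C\<close> before the
    later letters of \<open>B\<close>.\<close>
  then have R_sorted: "sorted_wrt (before \<pi>) ?R"
    unfolding late_word_def sorted_wrt_append using CB by simp
  define p where "p = length (takeWhile (\<lambda>x. before \<pi> x 1) ?R)"
  have tk: "take p ?R = takeWhile (\<lambda>x. before \<pi> x 1) ?R"
    unfolding p_def by (rule takeWhile_eq_take[symmetric])
  have dr: "drop p ?R = dropWhile (\<lambda>x. before \<pi> x 1) ?R"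
    unfolding p_def by (rule dropWhile_eq_drop[symmetric])
  have "p \<le> length ?R" unfolding p_def by (rule length_takeWhile_le)
  then have p: "p < 2 * t - 1 - j" using jt length_late_word[OF jt] by auto
  have R_1: "before \<pi> x 1" if "x \<in> set (take p ?R)" for x
    using that tk by (auto dest: set_takeWhileD)
  have one_R: "before \<pi> 1 x" if "x \<in> set (drop p ?R)" for x
    by (rule sorted_wrt_dropWhile_before[OF dist _ _ _ R_sorted that[unfolded dr]])
      (use t in \<open>auto simp: set set_late_word\<close>)
  have R_sub: "x \<in> set ?R" if "x \<in> set (take p ?R) \<or> x \<in> set (drop p ?R)" for x
    using that by (auto dest: in_set_takeD in_set_dropD)
  have "sorted_wrt (before \<pi>) (take p ?R @ drop p ?R)" using R_sorted by simp
  then have R_split: "sorted_wrt (before \<pi>) (take p ?R)" "sorted_wrt (before \<pi>) (drop p ?R)"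
    unfolding sorted_wrt_append by blast+
  have b_R: "before \<pi> (t + 1) x" if "x \<in> set ?R" for x
    using that b_C2 by (auto simp: R_eq intro: row)
  have C1_sorted: "sorted_wrt (before \<pi>) C1"
    using C_sorted unfolding C_split sorted_wrt_append by blast
  have A_sorted: "sorted_wrt (before \<pi>) [2..<t + 1]" by (rule upt) (auto intro: row)
  have one_A: "before \<pi> 1 x" if "x \<in> {2..t}" for x using that by (auto intro: row)
  have R_A: "before \<pi> x y" if "x \<in> set ?R" "y \<in> {2..t}" for x y
    using that by (auto simp: set_late_word intro!: BCA)
  have b_A: "before \<pi> (t + 1) y" if "y \<in> {2..t}" for y
    using that by (auto intro!: BCA)
  have inner: "sorted_wrt (before \<pi>) (take p ?R @ 1 # drop p ?R @ [2..<t + 1])"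
    using R_split A_sorted R_1 one_R one_A R_A R_sub trans[OF R_1 one_R]
    by (auto simp: sorted_wrt_append)
  have b_inner: "before \<pi> (t + 1) x" if "x \<in> set (take p ?R @ 1 # drop p ?R @ [2..<t + 1])" for x
    using that b_R R_sub firsts b_A by auto
  have "sorted_wrt (before \<pi>) (C1 @ (t + 1) # take p ?R @ 1 # drop p ?R @ [2..<t + 1])"
    unfolding sorted_wrt_append[of _ C1] sorted_wrt.simps(2)[of _ "t + 1"]
    using C1_sorted inner b_inner C1_b trans[OF C1_b b_inner] by (metis set_ConsD)
  then have "sorted_wrt (before \<pi>) (avoiding_word t j p)"
    by (simp add: avoiding_word_def C12)
  then have "\<pi> = avoiding_word t j p"
    using dist set jt avoiding_word_set avoiding_word_distinct sorted_wrt_before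
    by (intro sorted_wrt_before_unique[of \<pi>]) auto
  then show thesis using that jt p by blast
qed

lemma EN_avoiding_eq:
  assumes "t \<ge> 1"
  shows "EN_avoiding 3 t [1, 2, 4, 3] =
    (\<lambda>(j, p). avoiding_word t j p) ` (SIGMA j:{..<t}. {..<2 * t - 1 - j})"
proof (intro subset_antisym subsetI)
  fix \<pi> assume av: "\<pi> \<in> EN_avoiding 3 t [1, 2, 4, 3]"
  then have \<pi>: "distinct \<pi>" "set \<pi> = {1..3 * t}"
    by (auto simp: EN_avoiding_def EN_linear_extensions_def permutations_of_set_def)
  then have "avoiding_order t (before \<pi>)"
    using EN_avoiding_iff_avoiding_order[OF assms] av by blast
  then obtain j p where "j < t" "p < 2 * t - 1 - j" "\<pi> = avoiding_word t j p"
    by (rule avoiding_order_imp_avoiding_word[OF assms \<pi>])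
  then show "\<pi> \<in> (\<lambda>(j, p). avoiding_word t j p) ` (SIGMA j:{..<t}. {..<2 * t - 1 - j})"
    by (intro image_eqI[of _ _ "(j, p)"]) auto
next
  fix \<pi> assume "\<pi> \<in> (\<lambda>(j, p). avoiding_word t j p) ` (SIGMA j:{..<t}. {..<2 * t - 1 - j})"
  then show "\<pi> \<in> EN_avoiding 3 t [1, 2, 4, 3]"
    using EN_avoiding_iff_avoiding_order[OF assms] avoiding_word_distinct avoiding_word_set
      avoiding_order_avoiding_word by auto
qed

text \<open>The letters \<open>t + 1\<close> and \<open>1\<close> occur once each, so equal words
  agree before and after them: the prefix up to \<open>t + 1\<close> gives \<open>j\<close>, and the
  stretch from there to \<open>1\<close> gives \<open>p\<close>.\<close>

lemma avoiding_word_inj: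
  "inj_on (\<lambda>(j, p). avoiding_word t j p) (SIGMA j:{..<t}. {..<2 * t - 1 - j})"
proof (rule inj_onI, clarify)
  fix j p j' p'
  assume j: "j < t" "j' < t" and p: "p < 2 * t - 1 - j" "p' < 2 * t - 1 - j'"
    and eq: "avoiding_word t j p = avoiding_word t j' p'"
  have "[2 * t + 1..<2 * t + 2 + j] = [2 * t + 1..<2 * t + 2 + j'] \<and>
      take p (late_word t j) @ 1 # drop p (late_word t j) @ [2..<t + 1] =
      take p' (late_word t j') @ 1 # drop p' (late_word t j') @ [2..<t + 1]"
    using eq avoiding_word_distinct[OF j(1), of p] avoiding_word_distinct[OF j(2), of p']
    unfolding avoiding_word_def by (subst (asm) append_Cons_eq_iff) auto
  then have len: "length [2 * t + 1..<2 * t + 2 + j] = length [2 * t + 1..<2 * t + 2 + j']"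
    and tail: "take p (late_word t j) @ 1 # drop p (late_word t j) @ [2..<t + 1] =
      take p' (late_word t j') @ 1 # drop p' (late_word t j') @ [2..<t + 1]" by auto
  have jj: "j = j'" using len by simp
  have "take p (late_word t j) = take p' (late_word t j')"
    using tail avoiding_word_distinct[OF j(1), of p] avoiding_word_distinct[OF j(2), of p']
    unfolding avoiding_word_def by (subst (asm) append_Cons_eq_iff) auto
  then have "length (take p (late_word t j)) = length (take p' (late_word t j'))" by simp
  then show "j = j' \<and> p = p'" using jj p length_late_word[OF j(1)] by simp
qed

section \<open>Inversions\<close>

lemma inv_count_Nil [simp]: "inv_count [] = 0"
  by (simp add: inv_count_def)

text \<open>Inversions split into those using position 0 and those of the tail, shifted by
  one.\<close>

lemma inv_count_Cons [simp]: "inv_count (x # xs) = length (filter (\<lambda>y. y < x) xs) + inv_count xs"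
proof -
  let ?S = "{(i, j). i < j \<and> j < length xs \<and> xs ! i > xs ! j}"
  let ?T = "{j. j < length xs \<and> xs ! j < x}"
  have eq: "{(i, j). i < j \<and> j < length (x # xs) \<and> (x # xs) ! i > (x # xs) ! j} =
      (\<lambda>j. (0, Suc j)) ` ?T \<union> (\<lambda>(i, j). (Suc i, Suc j)) ` ?S" (is "?L = ?A \<union> ?B")
  proof (intro subset_antisym subsetI)
    fix u assume "u \<in> ?L"
    then obtain i j where u: "u = (i, Suc j)" "i < Suc j" "j < length xs" "(x # xs) ! i > xs ! j"
      by (cases u; cases "snd u") auto
    then show "u \<in> ?A \<union> ?B" by (cases i) auto
  qed auto
  have fin: "finite ?S" by (rule finite_subset[of _ "{..<length xs} \<times> {..<length xs}"]) auto
  have "card ?L = card ?A + card ?B"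
    unfolding eq using fin by (intro card_Un_disjoint) auto
  also have "card ?A = card ?T" by (intro card_image) (auto simp: inj_on_def)
  also have "card ?B = card ?S" by (intro card_image) (auto simp: inj_on_def)
  finally show ?thesis by (simp add: inv_count_def length_filter_conv_card)
qed

lemma inv_count_append:
  "inv_count (xs @ ys) =
    inv_count xs + inv_count ys + (\<Sum>x\<leftarrow>xs. length (filter (\<lambda>y. y < x) ys))"
  by (induction xs) auto

lemma inv_count_append_greater:
  assumes "\<And>x y. x \<in> set xs \<Longrightarrow> y \<in> set ys \<Longrightarrow> y < x"
  shows "inv_count (xs @ ys) = inv_count xs + inv_count ys + length xs * length ys"
proof -
  have "(\<Sum>x\<leftarrow>xs. length (filter (\<lambda>y. y < x) ys)) = (\<Sum>x\<leftarrow>xs. length ys)"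
    using assms by (intro arg_cong[of _ _ sum_list] map_cong) auto
  then show ?thesis by (simp add: inv_count_append sum_list_triv)
qed

lemma inv_count_sorted: "sorted xs \<Longrightarrow> inv_count xs = 0"
  by (induction xs) (fastforce simp: filter_empty_conv)+

lemma inv_count_upt [simp]: "inv_count [m..<n] = 0"
  by (simp add: inv_count_sorted)

text \<open>The new letter is inverted with exactly the letters in front of it.\<close>

lemma inv_count_insert_least:
  assumes "\<And>x. x \<in> set (xs @ ys) \<Longrightarrow> a < x"
  shows "inv_count (xs @ a # ys) = inv_count (xs @ ys) + length xs"
proof -
  have "filter (\<lambda>y. y < a) ys = []" using assms by (fastforce simp: filter_empty_conv)
  moreover have "(\<Sum>x\<leftarrow>xs. length (filter (\<lambda>y. y < x) (a # ys))) =
      (\<Sum>x\<leftarrow>xs. length (filter (\<lambda>y. y < x) ys)) + length xs"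
    using assms by (induction xs) auto
  ultimately show ?thesis unfolding inv_count_append by simp
qed

text \<open>With \<open>t = j + k + 1\<close>, the contributions are: \<open>k * (j + k)\<close>
  inside the late letters, \<open>p\<close> from \<open>1\<close>,
  \<open>(j + 2 * k) * (j + k)\<close> from late letters over \<open>2..t\<close>, \<open>t\<close>
  from \<open>t + 1\<close> over \<open>A\<close>, and \<open>2 * t\<close> from each of the
  \<open>j + 1\<close> leading letters of \<open>C\<close>.\<close>

lemma inv_count_avoiding_word:
  assumes j: "j < t" and p: "p < 2 * t - 1 - j"
  shows "inv_count (avoiding_word t j p) = 3 * (t\<^sup>2 - t + 1) + (2 * j + p)"
proof -
  \<comment> \<open>\<open>k\<close> is the number of late letters of \<open>C\<close>; it
    eliminates truncated subtraction.\<close>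
  obtain k where t: "t = Suc (j + k)" using j less_iff_Suc_add by blast
  let ?R = "late_word t j" and ?C1 = "[2 * t + 1..<2 * t + 2 + j]"
  let ?T = "take p ?R" and ?D = "drop p ?R"
  have R_len: "length ?R = j + 2 * k" using length_late_word[OF j] t by simp
  have p_len: "length ?T = p" using R_len p t by simp
  have memT: "t + 2 \<le> x" if "x \<in> set ?T" for x
    using that by (auto dest!: in_set_takeD simp: set_late_word)
  have memD: "t + 2 \<le> x" if "x \<in> set ?D" for x
    using that by (auto dest!: in_set_dropD simp: set_late_word)
  have R_inv: "inv_count ?R = k * (j + k)"
    unfolding late_word_def by (subst inv_count_append_greater) (auto simp: t)
  have TD: "inv_count (?T @ ?D @ [2..<t + 1]) = inv_count (?T @ ?D) + inv_count [2..<t + 1]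
      + length (?T @ ?D) * length [2..<t + 1]"
    unfolding append_assoc[symmetric]
    by (rule inv_count_append_greater) (auto simp: set_late_word dest!: memT memD)
  have "inv_count (?T @ 1 # (?D @ [2..<t + 1])) = inv_count (?T @ (?D @ [2..<t + 1])) + length ?T"
    by (rule inv_count_insert_least) (auto simp: set_late_word dest!: memT memD)
  then have Y: "inv_count (?T @ 1 # ?D @ [2..<t + 1]) = k * (j + k) + p + (j + 2 * k) * (j + k)"
    using TD R_inv p_len R_len t by simp
  have fT: "filter (\<lambda>y. y < t + 1) ?T = []" "filter (\<lambda>y. y < t + 1) ?D = []"
    by (auto simp: filter_empty_conv dest!: memT memD)
  have fA: "filter (\<lambda>y. y < t + 1) [2..<t + 1] = [2..<t + 1]"
    by (auto simp: filter_id_conv)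
  have Z: "inv_count ((t + 1) # ?T @ 1 # ?D @ [2..<t + 1]) =
      t + (k * (j + k) + p + (j + 2 * k) * (j + k))"
    using Y fT fA by (simp add: t)
  let ?U = "(t + 1) # ?T @ 1 # ?D @ [2..<t + 1]"
  \<comment> \<open>Behind a leading letter of \<open>C\<close>, the smaller letters are exactly
    those of \<open>A\<close> and \<open>B\<close>.\<close>
  have cross: "length (filter (\<lambda>y. y < x) ?U) = 2 * t" if "x \<in> set ?C1" for x
  proof -
    have "filter (\<lambda>y. y < x) ?R = [t + 2..<2 * t + 1]"
      using that by (auto simp: late_word_def filter_empty_conv filter_id_conv)
    then have "length (filter (\<lambda>y. y < x) (?T @ ?D)) = j + k" using t by simp
    then have "length (filter (\<lambda>y. y < x) ?T) + length (filter (\<lambda>y. y < x) ?D) = j + k"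
      unfolding filter_append by simp
    moreover have "filter (\<lambda>y. y < x) [2..<t + 1] = [2..<t + 1]"
      using that by (auto simp: filter_id_conv)
    ultimately show ?thesis using that t by simp
  qed
  have "(\<Sum>x\<leftarrow>?C1. length (filter (\<lambda>y. y < x) ?U)) = (\<Sum>x\<leftarrow>?C1. 2 * t)"
    using cross by (intro arg_cong[of _ _ sum_list] map_cong) auto
  also have "\<dots> = Suc j * (2 * t)" by (simp add: sum_list_triv)
  finally have "inv_count (avoiding_word t j p) =
      t + (k * (j + k) + p + (j + 2 * k) * (j + k)) + Suc j * (2 * t)"
    using Z unfolding avoiding_word_def inv_count_append[of ?C1] by simp
  moreover have "t\<^sup>2 - t = (j + k) * Suc (j + k)" by (simp add: t power2_eq_square)
  ultimately show ?thesis by (simp add: t algebra_simps)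
qed

section \<open>The generating function\<close>

text \<open>Clearing denominators makes the identity valid in every commutative ring. Summing over
  \<open>p\<close> first leaves two geometric series in \<open>j\<close>, with ratios
  \<open>q\<^sup>2\<close> and \<open>q\<close>.\<close>

lemma geometric_double_sum:
  fixes q :: "'a :: comm_ring_1"
  assumes "t \<ge> 1"
  shows "(1 - q) * (1 - q\<^sup>2) * (\<Sum>j<t. \<Sum>p<2 * t - 1 - j. q ^ (2 * j + p)) =
    1 - q ^ (2 * t - 1) - 2 * q ^ (2 * t) + q ^ (3 * t - 1) + q ^ (3 * t)"
proof -
  obtain n where t: "t = Suc n" using assms by (cases t) auto
  have inner: "(1 - q) * (\<Sum>p<2 * t - 1 - j. q ^ (2 * j + p)) = (q\<^sup>2) ^ j - q ^ (2 * t - 1) * q ^ j"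
    if "j < t" for j
  proof -
    have "(1 - q) * (\<Sum>p<2 * t - 1 - j. q ^ (2 * j + p)) =
        q ^ (2 * j) * ((1 - q) * (\<Sum>p<2 * t - 1 - j. q ^ p))"
      by (simp add: power_add sum_distrib_left mult_ac)
    also have "\<dots> = q ^ (2 * j) - q ^ (2 * j + (2 * t - 1 - j))"
      by (simp only: one_diff_power_eq[symmetric] power_add right_diff_distrib mult_1_right)
    also have "2 * j + (2 * t - 1 - j) = 2 * t - 1 + j" using that by simp
    finally show ?thesis by (simp add: power_mult power_add)
  qed
  have "(1 - q) * (\<Sum>j<t. \<Sum>p<2 * t - 1 - j. q ^ (2 * j + p)) =
      (\<Sum>j<t. (1 - q) * (\<Sum>p<2 * t - 1 - j. q ^ (2 * j + p)))"
    by (rule sum_distrib_left)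
  also have "\<dots> = (\<Sum>j<t. (q\<^sup>2) ^ j - q ^ (2 * t - 1) * q ^ j)"
    using inner by (intro sum.cong refl) simp
  also have "\<dots> = (\<Sum>j<t. (q\<^sup>2) ^ j) - q ^ (2 * t - 1) * (\<Sum>j<t. q ^ j)"
    by (simp only: sum_subtractf sum_distrib_left)
  finally have outer: "(1 - q) * (\<Sum>j<t. \<Sum>p<2 * t - 1 - j. q ^ (2 * j + p)) =
      (\<Sum>j<t. (q\<^sup>2) ^ j) - q ^ (2 * t - 1) * (\<Sum>j<t. q ^ j)" .
  have "(1 - q) * (1 - q\<^sup>2) * (\<Sum>j<t. \<Sum>p<2 * t - 1 - j. q ^ (2 * j + p)) =
      (1 - q\<^sup>2) * ((\<Sum>j<t. (q\<^sup>2) ^ j) - q ^ (2 * t - 1) * (\<Sum>j<t. q ^ j))"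
    unfolding outer[symmetric] by (simp only: mult_ac)
  \<comment> \<open>Factoring \<open>1 - q\<^sup>2\<close> as \<open>(1 + q) * (1 - q)\<close>
    supplies the factor that closes the second series.\<close>
  also have "\<dots> = (1 - q\<^sup>2) * (\<Sum>j<t. (q\<^sup>2) ^ j) -
      q ^ (2 * t - 1) * (1 + q) * ((1 - q) * (\<Sum>j<t. q ^ j))"
    by (simp add: algebra_simps power2_eq_square)
  also have "\<dots> = 1 - (q\<^sup>2) ^ t - q ^ (2 * t - 1) * (1 + q) * (1 - q ^ t)"
    by (simp only: one_diff_power_eq)
  also have "\<dots> = 1 - q ^ (2 * t - 1) - 2 * q ^ (2 * t) + q ^ (3 * t - 1) + q ^ (3 * t)"
  proof -
    have e: "2 * t - 1 = 2 * n + 1" "2 * t = 2 * n + 2" "3 * t - 1 = 3 * n + 2" "3 * t = 3 * n + 3"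
      by (simp_all add: t)
    show ?thesis
      unfolding e t power_mult[symmetric]
      by (simp add: algebra_simps power_add power2_eq_square power3_eq_cube power_mult)
  qed
  finally show ?thesis .
qed

text \<open>Powers of \<open>monom 1 1\<close> replace monomials of varying degree, so that
  \<open>to_fract\<close> turns each of them into a power of \<open>q_var\<close>.\<close>

lemma EN_genfun_3_1243:
  assumes "t \<ge> 1"
  shows "EN_genfun 3 t [1, 2, 4, 3] =
    monom 1 1 ^ (3 * (t\<^sup>2 - t + 1)) * (\<Sum>j<t. \<Sum>p<2 * t - 1 - j. monom 1 1 ^ (2 * j + p))"
proof -
  have "EN_genfun 3 t [1, 2, 4, 3] =
      (\<Sum>(j, p)\<in>(SIGMA j:{..<t}. {..<2 * t - 1 - j}). monom 1 (inv_count (avoiding_word t j p)))"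
    unfolding EN_genfun_def EN_avoiding_eq[OF assms] sum.reindex[OF avoiding_word_inj]
    by (simp add: case_prod_unfold)
  also have "\<dots> = (\<Sum>(j, p)\<in>(SIGMA j:{..<t}. {..<2 * t - 1 - j}).
      monom 1 1 ^ (3 * (t\<^sup>2 - t + 1)) * monom 1 1 ^ (2 * j + p))"
    by (rule sum.cong[OF refl])
      (auto simp: inv_count_avoiding_word power_add[symmetric] monom_power mult_monom)
  finally show ?thesis
    by (simp add: sum.Sigma[symmetric] sum_distrib_left)
qed

theorem theorem3p1:
  fixes t :: nat
  assumes "t \<ge> 1"
  shows "to_fract (EN_genfun 3 t [1, 2, 4, 3]) =
    q_var ^ (3 * (t\<^sup>2 - t + 1)) *
      (1 - q_var ^ (2 * t - 1) - 2 * q_var ^ (2 * t) + q_var ^ (3 * t - 1) + q_var ^ (3 * t)) /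
      ((1 - q_var) * (1 - q_var\<^sup>2))"
proof -
  have hom: "to_fract (x ^ n) = to_fract x ^ n" for x :: "int poly" and n
    by (induction n) simp_all
  have hom_sum: "to_fract (sum f S) = (\<Sum>x\<in>S. to_fract (f x))" for f :: "nat \<Rightarrow> int poly" and S
    by (induction S rule: infinite_finite_induct) simp_all
  have gf: "to_fract (EN_genfun 3 t [1, 2, 4, 3]) =
      q_var ^ (3 * (t\<^sup>2 - t + 1)) * (\<Sum>j<t. \<Sum>p<2 * t - 1 - j. q_var ^ (2 * j + p))"
    unfolding EN_genfun_3_1243[OF assms] q_var_def by (simp add: hom hom_sum)
  \<comment> \<open>Degrees show that no positive power of the indeterminate is 1, so neither factor
    of the denominator vanishes.\<close>
  have ne: "q_var ^ n \<noteq> 1" if "n > 0" for n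
  proof
    assume "q_var ^ n = 1"
    then have "monom (1::int) n = 1"
      unfolding q_var_def hom[symmetric] monom_power
      by (metis mult.left_neutral power_one to_fract_1 to_fract_eq_iff)
    then show False using that degree_monom_eq[of "1::int" n] by simp
  qed
  have "1 - q_var \<noteq> 0" "1 - q_var\<^sup>2 \<noteq> 0" using ne[of 1] ne[of 2] by auto
  \<comment> \<open>Read from right to left, \<open>geometric_double_sum\<close> turns the numerator
    into the double sum times the denominator, which then cancels.\<close>
  then show ?thesis
    unfolding gf geometric_double_sum[OF assms, of q_var, symmetric] by simp
qed

end
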